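(* Let $\Omega\subset\mathbb R^n$ be a compact domain with smooth boundary. Then $B_\Omega(z)=-P_\Omega(z)$ for $-n-1<\mathrm{Re}\,z<-n$. Thus the beta function $B_\Omega$ is the analytic continuation of both the Riesz energy and minus the fractional perimeter.
   Context: The Riesz energy is $E_\Omega(z)=\int_{\Omega\times\Omega}|x-y|^z\,dxdy$, which converges for $\mathrm{Re}\,z>-n$. It extends by analytic continuation to a meromorphic function on $\mathbb C$, denoted $B_\Omega(z)$ (the beta function of $\Omega$). The fractional perimeter is $P_\Omega(z)=\int_{\Omega\times\Omega^c}|x-y|^z\,dxdy$, where $\Omega^c=\mathbb R^n\setminus\Omega$; this integral converges for $-n-1<\mathrm{Re}\,z<-n$. *)

theory Defs
  imports "HOL-Complex_Analysis.Complex_Analysis"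
begin

primrec C_diff_on :: "nat \<Rightarrow> ('a::real_normed_vector \<Rightarrow> 'b::real_normed_vector) \<Rightarrow> 'a set \<Rightarrow> bool" where
  "C_diff_on 0 f U \<longleftrightarrow> continuous_on U f"
| "C_diff_on (Suc k) f U \<longleftrightarrow>
     (\<forall>x\<in>U. f differentiable (at x)) \<and>
     (\<forall>v. C_diff_on k (\<lambda>x. frechet_derivative f (at x) v) U)"

text \<open>
  Meant for open \<open>U\<close>. Asking continuity of the iterated directional derivatives in all
  directions is, in finite dimension, the usual \<open>C\<^sup>\<infinity>\<close>.
\<close>

definition smooth_on :: "('a::real_normed_vector \<Rightarrow> 'b::real_normed_vector) \<Rightarrow> 'a set \<Rightarrow> bool" where
  "smooth_on f U \<longleftrightarrow> (\<forall>k. C_diff_on k f U)"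

text \<open>
  Near each boundary point the set is a sublevel set \<open>\<rho> \<le> 0\<close> of a smooth function without
  critical points. Hence the boundary is locally \<open>\<rho> = 0\<close>, the set lies on one side of it, and
  by the implicit function theorem a compact such set is a compact submanifold with boundary
  of codimension 0. Connectedness is not required.
\<close>

definition smooth_boundary :: "'a::euclidean_space set \<Rightarrow> bool" where
  "smooth_boundary \<Omega> \<longleftrightarrow>
     (\<forall>p\<in>frontier \<Omega>. \<exists>U (\<rho> :: 'a \<Rightarrow> real).
        open U \<and> p \<in> U \<and> smooth_on \<rho> U \<and>
        (\<forall>x\<in>U. \<exists>v. frechet_derivative \<rho> (at x) v \<noteq> 0) \<and>
        \<Omega> \<inter> U = {x \<in> U. \<rho> x \<le> 0})"

definition compact_smooth_domain :: "'a::euclidean_space set \<Rightarrow> bool" where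
  "compact_smooth_domain \<Omega> \<longleftrightarrow> compact \<Omega> \<and> smooth_boundary \<Omega>"

text \<open>
  On the diagonal, which is a null set, \<open>powr\<close> returns 0.
\<close>

definition riesz_kernel :: "complex \<Rightarrow> 'a::euclidean_space \<times> 'a \<Rightarrow> complex" where
  "riesz_kernel z = (\<lambda>(x, y). complex_of_real (norm (x - y)) powr z)"

definition riesz_energy :: "'a::euclidean_space set \<Rightarrow> complex \<Rightarrow> complex" where
  "riesz_energy \<Omega> z = set_lebesgue_integral lborel (\<Omega> \<times> \<Omega>) (riesz_kernel z)"

definition fractional_perimeter :: "'a::euclidean_space set \<Rightarrow> complex \<Rightarrow> complex" where
  "fractional_perimeter \<Omega> z = set_lebesgue_integral lborel (\<Omega> \<times> (- \<Omega>)) (riesz_kernel z)"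

text \<open>
  Meromorphic functions are normalised (removable singularities removed, value 0 at poles), so
  that values are meaningful at every point; by the identity theorem a meromorphic
  continuation from a nonempty open set is then unique.
\<close>

definition beta_function_of ::
    "'a::euclidean_space set \<Rightarrow> (complex \<Rightarrow> complex) \<Rightarrow> bool" where
  "beta_function_of \<Omega> B \<longleftrightarrow>
     B nicely_meromorphic_on UNIV \<and>
     (\<forall>z. Re z > - real DIM('a) \<longrightarrow> B z = riesz_energy \<Omega> z)"

definition analytic_continuation_from ::
    "complex set \<Rightarrow> (complex \<Rightarrow> complex) \<Rightarrow> (complex \<Rightarrow> complex) \<Rightarrow> bool" where
  "analytic_continuation_from D f F \<longleftrightarrow>
     open D \<and> D \<noteq> {} \<and> f holomorphic_on D \<and>
     F nicely_meromorphic_on UNIV \<and> (\<forall>z\<in>D. F z = f z)"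

end

theory Submission
  imports Defs
begin

text \<open>
  Let \<open>n\<close> be the dimension and \<open>R\<close> larger than the diameter of \<open>\<Omega>\<close>. Write
  \<open>X\<close> for the set of pairs \<open>(x, y)\<close> with \<open>x \<in> \<Omega>\<close>,
  \<open>y \<notin> \<Omega>\<close> and \<open>norm (x - y) < R\<close>, and \<open>I S z\<close> for the integral of
  \<open>norm (x - y) powr z\<close> over a set \<open>S\<close> of pairs. Let \<open>N\<close> and \<open>F\<close> be the sets
  of pairs with \<open>x \<in> \<Omega>\<close> and with distance less than \<open>R\<close>, respectively at least
  \<open>R\<close>. Then the Riesz energy is \<open>I N z - I X z\<close> and the fractional perimeter is
  \<open>I X z + I F z\<close> (\<open>riesz_integral_split\<close>). It remains to see that \<open>I X\<close> is holomorphic for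
  \<open>Re z > - n - 1\<close>, across the line \<open>Re z = - n\<close>, and that \<open>I N\<close>, which converges to
  the right of this line, continues to \<open>- I F\<close>, which converges to its left.

  The second point is a scaling argument in place of polar coordinates. Let \<open>A\<close> be the set of pairs with
  \<open>x \<in> \<Omega>\<close> and distance in \<open>{R..<2 * R}\<close>. Doubling all displacements multiplies such
  integrals by \<open>2 powr (z + n)\<close>, whence \<open>I A z = (2 powr (z + n) - 1) * I N z\<close> on the right
  (\<open>riesz_integral_annulus_near\<close>) and \<open>I A z = - (2 powr (z + n) - 1) * I F z\<close> on the left
  (\<open>riesz_integral_annulus_far\<close>), while \<open>I A\<close> is entire.

  The first point rests on the smooth boundary: the measure of the set of \<open>x \<in> \<Omega>\<close> with
  \<open>x + h \<notin> \<Omega>\<close> is at most \<open>C * norm h\<close> (\<open>emeasure_exit_set_le\<close>), so that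
  \<open>I X\<close> gains one power of the distance (\<open>riesz_mass_exit_finite\<close>). Holomorphy of all these
  integrals is dominated convergence (\<open>holomorphic_on_integral_powr\<close>), and the identity theorem for
  meromorphic functions on the half plane \<open>Re z > - n - 1\<close> finishes the proof.
\<close>

section \<open>Integrals of powers with a complex exponent\<close>

lemma powr_of_real_nonneg:
  fixes t :: real
  assumes "t \<ge> 0"
  shows "complex_of_real t powr z = (if t = 0 then 0 else exp (z * of_real (ln t)))"
  using assms by (auto simp: powr_def Ln_of_real)

lemma borel_measurable_of_real_powr:
  fixes w :: "'a \<Rightarrow> real"
  assumes [measurable]: "w \<in> borel_measurable M" and nonneg: "\<And>x. w x \<ge> 0"
  shows "(\<lambda>x. complex_of_real (w x) powr z) \<in> borel_measurable M"
  using nonneg by (simp add: powr_of_real_nonneg)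

lemma integrable_of_real_powr:
  fixes w :: "'a \<Rightarrow> real"
  assumes "w \<in> borel_measurable M" "\<And>x. w x \<ge> 0" "integrable M (\<lambda>x. w x powr Re z)"
  shows "integrable M (\<lambda>x. complex_of_real (w x) powr z)"
  by (rule Bochner_Integration.integrable_bound[OF assms(3)])
     (use assms in \<open>auto simp: norm_powr_real_powr\<close>)

text \<open>
  The majorant for differentiating \<open>t powr z\<close> under the integral sign. The derivative costs a
  factor \<open>ln t\<close>, which grows more slowly than every power both at \<open>0\<close> and at infinity; hence
  the two exponents on either side of \<open>Re z\<close>.
\<close>

lemma norm_powr_diff_quotient_le:
  fixes t \<delta> :: real and z h :: complex
  assumes t: "t \<ge> 0" and \<delta>: "\<delta> > 0" and h: "h \<noteq> 0" "norm h < \<delta>"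
  shows "norm ((complex_of_real t powr (z + h) - complex_of_real t powr z) / h)
           \<le> (t powr (Re z + 2 * \<delta>) + t powr (Re z - 2 * \<delta>)) / \<delta>"
proof (cases "t = 0")
  case False
  define L where "L = ln t"
  have eq: "complex_of_real t powr (z + h) - complex_of_real t powr z =
          exp (z * L) * (exp (h * L) - 1)"
    using False t by (simp add: powr_of_real_nonneg L_def exp_add[symmetric] algebra_simps)
  have "norm (exp (h * L) - 1) \<le> exp \<bar>Re (h * L)\<bar> * norm (h * L)"
    using Taylor_exp[of "h * L" 0] by simp
  also have "\<dots> \<le> exp (\<delta> * \<bar>L\<bar>) * norm (h * L)"
  proof (intro mult_right_mono)
    have "\<bar>Re h\<bar> \<le> \<delta>" using h(2) abs_Re_le_cmod[of h] by linarith
    then show "exp \<bar>Re (h * L)\<bar> \<le> exp (\<delta> * \<bar>L\<bar>)"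
      by (simp add: abs_mult mult_right_mono)
  qed auto
  finally have 1: "norm (exp (h * L) - 1) / norm h \<le> exp (\<delta> * \<bar>L\<bar>) * \<bar>L\<bar>"
    using h(1) by (simp add: norm_mult divide_simps mult_ac)
  have "\<delta> * \<bar>L\<bar> \<le> exp (\<delta> * \<bar>L\<bar>)"
    using exp_ge_add_one_self[of "\<delta> * \<bar>L\<bar>"] by linarith
  then have "exp (\<delta> * \<bar>L\<bar>) * \<bar>L\<bar> \<le> exp (\<delta> * \<bar>L\<bar>) * (exp (\<delta> * \<bar>L\<bar>) / \<delta>)"
    using \<delta> by (intro mult_left_mono) (auto simp: field_simps)
  also have "\<dots> = exp (2 * \<delta> * \<bar>L\<bar>) / \<delta>"
    by (simp add: exp_add[symmetric])
  also have "\<dots> \<le> (exp (2 * \<delta> * L) + exp (- (2 * \<delta> * L))) / \<delta>"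
    using \<delta> by (intro divide_right_mono) (auto simp: abs_if)
  finally have 2: "norm (exp (h * L) - 1) / norm h \<le> (exp (2 * \<delta> * L) + exp (- (2 * \<delta> * L))) / \<delta>"
    using 1 by linarith
  have "norm ((complex_of_real t powr (z + h) - complex_of_real t powr z) / h)
      = exp (Re z * L) * (norm (exp (h * L) - 1) / norm h)"
    by (simp add: eq norm_mult norm_divide)
  also have "\<dots> \<le> exp (Re z * L) * ((exp (2 * \<delta> * L) + exp (- (2 * \<delta> * L))) / \<delta>)"
    using 2 by (intro mult_left_mono) auto
  also have "\<dots> = (t powr (Re z + 2 * \<delta>) + t powr (Re z - 2 * \<delta>)) / \<delta>"
    using False t by (simp add: powr_def L_def exp_add[symmetric] algebra_simps)
  finally show ?thesis .
qed (use \<delta> in auto)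

text \<open>
  An integral of powers with variable exponent is holomorphic wherever it converges in an open range
  of exponents. Points with \<open>w x = 0\<close> contribute nothing because \<open>0 powr z = 0\<close>, so
  a factor \<open>indicator S\<close> in \<open>w\<close> restricts the integral to \<open>S\<close>.
\<close>

lemma holomorphic_on_integral_powr:
  fixes w :: "'a \<Rightarrow> real" and S :: "real set"
  assumes w: "w \<in> borel_measurable M" and nonneg: "\<And>x. w x \<ge> 0" and S: "open S"
    and int: "\<And>s. s \<in> S \<Longrightarrow> integrable M (\<lambda>x. w x powr s)"
  shows "(\<lambda>z. \<integral>x. complex_of_real (w x) powr z \<partial>M) holomorphic_on {z. Re z \<in> S}"
proof -
  define F where "F z = (\<integral>x. complex_of_real (w x) powr z \<partial>M)" for z
  have "\<exists>D. (F has_field_derivative D) (at z)" if z: "Re z \<in> S" for z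
  proof -
    obtain e where e: "e > 0" "ball (Re z) e \<subseteq> S"
      using S z openE by blast
    define \<delta> where "\<delta> = e / 3"
    have \<delta>0: "\<delta> > 0" using e by (simp add: \<delta>_def)
    have inS: "u \<in> S" if "\<bar>u - Re z\<bar> \<le> 2 * \<delta>" for u
    proof -
      have "u \<in> ball (Re z) e" using e that by (simp add: \<delta>_def dist_real_def abs_minus_commute)
      then show ?thesis using e by blast
    qed
    define G where "G h x = (complex_of_real (w x) powr (z + h) - complex_of_real (w x) powr z) / h" for h x
    define G0 where "G0 x = of_real (ln (w x)) * complex_of_real (w x) powr z" for x
    have meas: "(\<lambda>x. complex_of_real (w x) powr u) \<in> borel_measurable M" for u
      using w nonneg by (rule borel_measurable_of_real_powr)
    have "((\<lambda>h. (F (z + h) - F z) / h) \<longlongrightarrow> integral\<^sup>L M G0) (at 0)"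
      unfolding tendsto_at_iff_sequentially
    proof safe
      fix X :: "nat \<Rightarrow> complex"
      assume X: "\<forall>i. X i \<in> UNIV - {0}" "X \<longlonglongrightarrow> 0"
      have "eventually (\<lambda>i. norm (X i) < \<delta>) sequentially"
        using X(2) \<delta>0 by (auto simp: tendsto_iff dist_norm)
      then obtain N where N: "\<And>i. i \<ge> N \<Longrightarrow> norm (X i) < \<delta>"
        by (auto simp: eventually_sequentially)
      define Y where "Y i = X (i + N)" for i
      have Y: "Y i \<noteq> 0" "norm (Y i) < \<delta>" for i using X(1) N by (auto simp: Y_def)
      have Ylim: "Y \<longlonglongrightarrow> 0" unfolding Y_def using X(2) by (rule LIMSEQ_ignore_initial_segment)
      have "(\<lambda>i. integral\<^sup>L M (G (Y i))) \<longlonglongrightarrow> integral\<^sup>L M G0"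
      proof (rule integral_dominated_convergence)
        show "integrable M (\<lambda>x. (w x powr (Re z + 2 * \<delta>) + w x powr (Re z - 2 * \<delta>)) / \<delta>)"
          using inS \<delta>0 by (intro integrable_divide Bochner_Integration.integrable_add int) auto
        show "G0 \<in> borel_measurable M" unfolding G0_def using meas w by measurable
        show "G (Y i) \<in> borel_measurable M" for i
          unfolding G_def by (intro borel_measurable_divide borel_measurable_diff meas) auto
        show "AE x in M. norm (G (Y i) x) \<le> (w x powr (Re z + 2 * \<delta>) + w x powr (Re z - 2 * \<delta>)) / \<delta>" for i
          unfolding G_def using norm_powr_diff_quotient_le[OF nonneg \<delta>0 Y] by (intro AE_I2)
        show "AE x in M. (\<lambda>i. G (Y i) x) \<longlonglongrightarrow> G0 x"
        proof (rule AE_I2)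
          fix x
          have "((\<lambda>u. complex_of_real (w x) powr u) has_field_derivative G0 x) (at z)"
          proof (cases "w x = 0")
            case False
            then show ?thesis using nonneg[of x]
              unfolding G0_def by (auto intro!: derivative_eq_intros simp: Ln_of_real)
          qed (auto simp: G0_def)
          then have "((\<lambda>h. G h x) \<longlongrightarrow> G0 x) (at 0)"
            by (simp add: DERIV_def G_def)
          then show "(\<lambda>i. G (Y i) x) \<longlonglongrightarrow> G0 x"
            using Ylim Y(1) unfolding tendsto_at_iff_sequentially comp_def by blast
        qed
      qed
      moreover have "integral\<^sup>L M (G (Y i)) = (F (z + Y i) - F z) / Y i" for i
      proof -
        have "Re (z + Y i) \<in> S"
          using Y(2)[of i] abs_Re_le_cmod[of "Y i"] \<delta>0 by (intro inS) auto
        then have "integrable M (\<lambda>x. complex_of_real (w x) powr (z + Y i))"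
                  "integrable M (\<lambda>x. complex_of_real (w x) powr z)"
          using z by (auto intro!: integrable_of_real_powr w nonneg int)
        then show ?thesis unfolding G_def F_def by simp
      qed
      ultimately have "(\<lambda>i. (F (z + X (i + N)) - F z) / X (i + N)) \<longlonglongrightarrow> integral\<^sup>L M G0"
        by (simp add: Y_def)
      then show "((\<lambda>h. (F (z + h) - F z) / h) \<circ> X) \<longlonglongrightarrow> integral\<^sup>L M G0"
        unfolding comp_def by (rule LIMSEQ_offset)
    qed
    then show ?thesis by (auto simp: DERIV_def)
  qed
  then have "F holomorphic_on {z. Re z \<in> S}"
    unfolding holomorphic_on_def
    by (metis field_differentiable_def has_field_derivative_at_within mem_Collect_eq)
  then show ?thesis by (simp add: F_def[abs_def])
qed

section \<open>Dilations and the convergence of radial integrals\<close>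

text \<open>
  The measure preserving substitution \<open>y = x + h\<close>: it separates the distance \<open>norm h\<close> from
  the position \<open>x\<close>.
\<close>

lemma nn_integral_lborel_shear:
  fixes f :: "'a::euclidean_space \<times> 'a \<Rightarrow> ennreal"
  assumes f[measurable]: "f \<in> borel_measurable borel"
  shows "(\<integral>\<^sup>+p. f p \<partial>lborel) = (\<integral>\<^sup>+h. \<integral>\<^sup>+x. f (x, x + h) \<partial>lborel \<partial>lborel)"
proof -
  have m: "f \<in> borel_measurable (lborel \<Otimes>\<^sub>M lborel)" by (simp add: lborel_prod)
  have m': "(\<lambda>(x, h). f (x, x + h)) \<in> borel_measurable (lborel \<Otimes>\<^sub>M lborel)"
  proof -
    have "(\<lambda>p::'a \<times> 'a. (fst p, fst p + snd p)) \<in> borel \<rightarrow>\<^sub>M borel"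
      by (intro borel_measurable_continuous_onI continuous_intros)
    from measurable_compose[OF this f] show ?thesis
      by (simp add: lborel_prod case_prod_unfold)
  qed
  have "(\<integral>\<^sup>+p. f p \<partial>lborel) = (\<integral>\<^sup>+x. \<integral>\<^sup>+y. f (x, y) \<partial>lborel \<partial>lborel)"
    using lborel.nn_integral_fst[OF m] by (simp add: lborel_prod)
  also have "\<dots> = (\<integral>\<^sup>+x. \<integral>\<^sup>+h. f (x, x + h) \<partial>lborel \<partial>lborel)"
  proof (rule nn_integral_cong)
    fix x :: 'a
    have "(\<integral>\<^sup>+y. f (x, y) \<partial>lborel) = (\<integral>\<^sup>+y. f (x, y) \<partial>distr lborel borel ((+) x))"
      by (simp add: lborel_distr_plus)
    also have "\<dots> = (\<integral>\<^sup>+h. f (x, x + h) \<partial>lborel)"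
      by (subst nn_integral_distr) auto
    finally show "(\<integral>\<^sup>+y. f (x, y) \<partial>lborel) = (\<integral>\<^sup>+h. f (x, x + h) \<partial>lborel)" .
  qed
  also have "\<dots> = (\<integral>\<^sup>+h. \<integral>\<^sup>+x. f (x, x + h) \<partial>lborel \<partial>lborel)"
    by (rule lborel_pair.Fubini'[OF m', symmetric])
  finally show ?thesis .
qed

lemma nn_integral_lborel_scaleR:
  fixes f :: "'a::euclidean_space \<Rightarrow> ennreal"
  assumes f[measurable]: "f \<in> borel_measurable borel" and c: "c > 0"
  shows "(\<integral>\<^sup>+x. f x \<partial>lborel) = ennreal (c ^ DIM('a)) * (\<integral>\<^sup>+x. f (c *\<^sub>R x) \<partial>lborel)"
  using c by (subst lborel_affine[of c 0])
    (simp_all add: nn_integral_density nn_integral_distr nn_integral_cmult)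

text \<open>
  Stretching the displacement of a pair while fixing its first point is a linear map of determinant
  \<open>c ^ DIM('a)\<close>. Stated for the measure itself, it also changes variables in Bochner
  integrals over pairs, where Fubini would need integrability at each step.
\<close>

lemma lborel_pair_dilation:
  fixes c :: real
  assumes c: "c > 0"
  defines "T \<equiv> \<lambda>p::'a::euclidean_space \<times> 'a. (fst p, fst p + c *\<^sub>R (snd p - fst p))"
  shows "lborel = density (distr lborel borel T) (\<lambda>_. ennreal (c ^ DIM('a)))"
proof (rule measure_eqI)
  fix A :: "('a \<times> 'a) set"
  assume "A \<in> sets lborel"
  then have A[measurable]: "A \<in> sets borel" by simp
  have T[measurable]: "T \<in> borel_measurable borel"
    unfolding T_def by (intro borel_measurable_continuous_onI continuous_intros)
  have m: "(\<lambda>h::'a. \<integral>\<^sup>+x. indicator A (x, x + h) \<partial>lborel) \<in> borel_measurable borel"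
  proof -
    have "(\<lambda>(h::'a, x). indicator A (x, x + h) :: ennreal) \<in> borel_measurable (lborel \<Otimes>\<^sub>M lborel)"
    proof -
      have "(\<lambda>p::'a \<times> 'a. (snd p, snd p + fst p)) \<in> borel \<rightarrow>\<^sub>M borel"
        by (intro borel_measurable_continuous_onI continuous_intros)
      from measurable_compose[OF this borel_measurable_indicator[OF A]] show ?thesis
        by (simp add: lborel_prod case_prod_unfold)
    qed
    from lborel.borel_measurable_nn_integral_fst[OF this] show ?thesis by simp
  qed
  have "emeasure lborel A = (\<integral>\<^sup>+h. \<integral>\<^sup>+x. indicator A (x, x + h) \<partial>lborel \<partial>lborel)"
    using nn_integral_lborel_shear[OF borel_measurable_indicator[OF A]] by simp
  also have "\<dots> = ennreal (c ^ DIM('a)) * (\<integral>\<^sup>+h. \<integral>\<^sup>+x. indicator A (x, x + c *\<^sub>R h) \<partial>lborel \<partial>lborel)"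
    by (rule nn_integral_lborel_scaleR[OF m c])
  also have "(\<integral>\<^sup>+h. \<integral>\<^sup>+x. indicator A (x, x + c *\<^sub>R h) \<partial>lborel \<partial>lborel) =
      (\<integral>\<^sup>+p. indicator A (T p) \<partial>lborel)"
  proof -
    have "(\<lambda>p. indicator A (T p) :: ennreal) \<in> borel_measurable borel" by measurable
    from nn_integral_lborel_shear[OF this] show ?thesis by (simp add: T_def)
  qed
  finally show "emeasure lborel A = emeasure (density (distr lborel borel T) (\<lambda>_. ennreal (c ^ DIM('a)))) A"
    using nn_integral_distr[of T lborel borel "indicator A"] A T
    by (simp add: emeasure_density nn_integral_cmult)
qed simp

text \<open>
  The token \<open>'a itself\<close> carries the dimension, which the value depends on but the other
  arguments do not mention.
\<close>

definition shell_integral :: "'a::euclidean_space itself \<Rightarrow> real \<Rightarrow> real \<Rightarrow> real \<Rightarrow> ennreal" where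
  "shell_integral _ s a b =
     (\<integral>\<^sup>+(h::'a). ennreal (norm h powr s) * indicator {h. a \<le> norm h \<and> norm h < b} h \<partial>lborel)"

lemma shell_integral_scale:
  assumes c: "c > 0"
  shows "shell_integral TYPE('a::euclidean_space) s (c * a) (c * b) =
     ennreal (c powr (s + DIM('a))) * shell_integral TYPE('a) s a b"
proof -
  have "shell_integral TYPE('a) s (c * a) (c * b) =
      c ^ DIM('a) * (\<integral>\<^sup>+(h::'a). ennreal (norm (c *\<^sub>R h) powr s) *
         indicator {h. c * a \<le> norm h \<and> norm h < c * b} (c *\<^sub>R h) \<partial>lborel)"
    unfolding shell_integral_def by (subst nn_integral_lborel_scaleR[OF _ c]) (simp_all)
  also have "(\<integral>\<^sup>+(h::'a). ennreal (norm (c *\<^sub>R h) powr s) *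
         indicator {h. c * a \<le> norm h \<and> norm h < c * b} (c *\<^sub>R h) \<partial>lborel)
     = (\<integral>\<^sup>+(h::'a). ennreal (c powr s) * (ennreal (norm h powr s) *
         indicator {h. a \<le> norm h \<and> norm h < b} h) \<partial>lborel)"
    using c by (intro nn_integral_cong)
      (auto simp: indicator_def powr_mult ennreal_mult)
  also have "\<dots> = ennreal (c powr s) * shell_integral TYPE('a) s a b"
    unfolding shell_integral_def by (rule nn_integral_cmult) measurable
  finally show ?thesis
    using c by (simp add: powr_add powr_realpow ennreal_mult mult_ac)
qed

lemma shell_integral_finite:
  assumes "a > 0"
  shows "shell_integral TYPE('a::euclidean_space) s a b < \<infinity>"
proof -
  have "shell_integral TYPE('a) s a b \<le>
     (\<integral>\<^sup>+(h::'a). ennreal (a powr s + b powr s) * indicator (ball 0 b) h \<partial>lborel)"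
    unfolding shell_integral_def
  proof (intro nn_integral_mono)
    fix h :: 'a
    have "norm h powr s \<le> a powr s + b powr s" if "a \<le> norm h" "norm h < b"
    proof (cases "s \<ge> 0")
      case True
      then have "norm h powr s \<le> b powr s" using that by (intro powr_mono2) auto
      then show ?thesis by (simp add: add_increasing)
    next
      case False
      then have "norm h powr s \<le> a powr s" using that assms by (intro powr_mono2') auto
      then show ?thesis by (simp add: add_increasing2)
    qed
    then show "ennreal (norm h powr s) * indicator {h. a \<le> norm h \<and> norm h < b} h
        \<le> ennreal (a powr s + b powr s) * indicator (ball 0 b) h"
      by (auto simp: indicator_def ennreal_leI simp del: ennreal_plus)
  qed
  also have "\<dots> = ennreal (a powr s + b powr s) * emeasure lborel (ball (0::'a) b)"
    by (rule nn_integral_cmult_indicator) simp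
  also have "\<dots> < \<infinity>"
    using emeasure_bounded_finite[OF bounded_ball, of "0::'a" b] by (simp add: ennreal_mult_less_top)
  finally show ?thesis .
qed

text \<open>
  Consecutive shells are dilates of each other by \<open>c\<close>, so their integrals form a geometric
  series.
\<close>

lemma suminf_shell_integral_finite:
  fixes a b c s :: real
  assumes c: "c > 0" "c powr (s + DIM('a::euclidean_space)) < 1" and a: "a > 0"
  shows "(\<Sum>k. shell_integral TYPE('a) s (c ^ k * a) (c ^ k * b)) < \<infinity>"
proof -
  define q where "q = c powr (s + DIM('a))"
  have q: "0 \<le> q" "q < 1" using c by (auto simp: q_def)
  have "shell_integral TYPE('a) s (c ^ k * a) (c ^ k * b) = ennreal (q ^ k) * shell_integral TYPE('a) s a b" for k
  proof -
    have "(c ^ k) powr (s + DIM('a)) = q ^ k"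
      using c(1) by (induction k) (simp_all add: q_def powr_mult)
    then show ?thesis using shell_integral_scale[of "c ^ k" s a b, where 'a='a] c(1) by simp
  qed
  then have "(\<Sum>k. shell_integral TYPE('a) s (c ^ k * a) (c ^ k * b)) =
      (\<Sum>k. ennreal (q ^ k)) * shell_integral TYPE('a) s a b"
    by simp
  also have "(\<Sum>k. ennreal (q ^ k)) = ennreal (\<Sum>k. q ^ k)"
    using q by (intro suminf_ennreal2 summable_geometric) auto
  finally show ?thesis
    using shell_integral_finite[OF a, of s b, where 'a='a] by (simp add: ennreal_mult_less_top)
qed

text \<open>
  Used with \<open>c = 1 / 2\<close> to integrate towards the origin and with \<open>c = 2\<close> to integrate
  towards infinity. The origin may be left uncovered because \<open>0 powr s = 0\<close>.
\<close>

lemma nn_integral_shell_cover_finite: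
  fixes D :: "'a::euclidean_space set" and a b c s :: real
  assumes c: "c > 0" "c powr (s + DIM('a)) < 1" and a: "a > 0"
    and cover: "\<And>h. h \<in> D \<Longrightarrow> h \<noteq> 0 \<Longrightarrow> \<exists>k. c ^ k * a \<le> norm h \<and> norm h < c ^ k * b"
  shows "(\<integral>\<^sup>+h. ennreal (norm h powr s) * indicator D h \<partial>lborel) < \<infinity>"
proof -
  have "(\<integral>\<^sup>+h. ennreal (norm h powr s) * indicator D h \<partial>lborel) \<le>
    (\<integral>\<^sup>+(h::'a). (\<Sum>k. ennreal (norm h powr s) * indicator {h. c ^ k * a \<le> norm h \<and> norm h < c ^ k * b} h) \<partial>lborel)"
  proof (intro nn_integral_mono)
    fix h :: 'a
    show "ennreal (norm h powr s) * indicator D h \<le>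
       (\<Sum>k. ennreal (norm h powr s) * indicator {h. c ^ k * a \<le> norm h \<and> norm h < c ^ k * b} h)"
    proof (cases "h \<in> D \<and> h \<noteq> 0")
      case True
      then obtain k where k: "c ^ k * a \<le> norm h" "norm h < c ^ k * b" using cover by blast
      have "ennreal (norm h powr s) * indicator D h =
          (\<Sum>j\<in>{k}. ennreal (norm h powr s) * indicator {h. c ^ j * a \<le> norm h \<and> norm h < c ^ j * b} h)"
        using True k by simp
      also have "\<dots> \<le> (\<Sum>k. ennreal (norm h powr s) * indicator {h. c ^ k * a \<le> norm h \<and> norm h < c ^ k * b} h)"
        by (rule sum_le_suminf) auto
      finally show ?thesis .
    qed auto
  qed
  also have "\<dots> = (\<Sum>k. shell_integral TYPE('a) s (c ^ k * a) (c ^ k * b))"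
    unfolding shell_integral_def by (rule nn_integral_suminf) measurable
  also have "\<dots> < \<infinity>" by (rule suminf_shell_integral_finite[OF c a])
  finally show ?thesis .
qed

lemma nn_integral_norm_powr_ball_finite:
  fixes R s :: real
  assumes s: "s > - real DIM('a::euclidean_space)"
  shows "(\<integral>\<^sup>+(h::'a). ennreal (norm h powr s) * indicator (ball 0 R) h \<partial>lborel) < \<infinity>"
proof (cases "R > 0")
  case True
  show ?thesis
  proof (rule nn_integral_shell_cover_finite[where c = "1/2" and a = "R / 2" and b = R])
    show "(1 / 2) powr (s + DIM('a)) < (1::real)"
    proof -
      have "(1 / 2) powr (s + DIM('a)) = 2 powr (- (s + DIM('a)))"
        by (simp add: powr_divide powr_add powr_diff powr_minus field_simps)
      also have "\<dots> < 1" using s by (intro powr_less_one) auto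
      finally show ?thesis .
    qed
    fix h :: 'a assume "h \<in> ball 0 R" "h \<noteq> 0"
    then have h: "norm h < R" "norm h > 0" by auto
    let ?P = "\<lambda>k. (1/2) ^ k * (R/2) \<le> norm h"
    have "\<exists>k. (1/2) ^ k < norm h / R"
      using real_arch_pow_inv[of "norm h / R" "1/2"] h True by auto
    then obtain k where "(1/2) ^ k < norm h / R" by blast
    then have "(1/2) ^ k * R < norm h" using True by (simp add: field_simps)
    moreover have "(1/2) ^ k * (R/2) \<le> (1/2) ^ k * R" using True by simp
    ultimately have "?P k" by linarith
    then have P: "?P (LEAST k. ?P k)" by (rule LeastI)
    have "norm h < (1/2) ^ (LEAST k. ?P k) * R"
    proof (cases "LEAST k. ?P k")
      case (Suc j)
      then have "\<not> ?P j" using not_less_Least[of j ?P] by simp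
      then show ?thesis using Suc by simp
    qed (use h in simp)
    with P show "\<exists>k. (1/2) ^ k * (R/2) \<le> norm h \<and> norm h < (1/2) ^ k * R" by blast
  qed (use True in auto)
qed (simp add: ball_empty)

lemma nn_integral_norm_powr_outside_finite:
  fixes R s :: real
  assumes s: "s < - real DIM('a::euclidean_space)" and R: "R > 0"
  shows "(\<integral>\<^sup>+(h::'a). ennreal (norm h powr s) * indicator (- ball 0 R) h \<partial>lborel) < \<infinity>"
proof (rule nn_integral_shell_cover_finite[where c = 2 and a = R and b = "2 * R"])
  show "2 powr (s + DIM('a)) < (1::real)"
    using s by (simp add: powr_less_one)
  fix h :: 'a assume "h \<in> - ball 0 R"
  then have h: "R \<le> norm h" by simp
  let ?P = "\<lambda>k. norm h < 2 ^ k * (2 * R)"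
  obtain k where "norm h / R < 2 ^ k" using real_arch_pow[of 2 "norm h / R"] by auto
  then have "norm h < 2 ^ k * R" using R by (simp add: field_simps)
  also have "\<dots> \<le> 2 ^ k * (2 * R)" using R by simp
  finally have "?P k" .
  then have P: "?P (LEAST k. ?P k)" by (rule LeastI)
  have "2 ^ (LEAST k. ?P k) * R \<le> norm h"
  proof (cases "LEAST k. ?P k")
    case (Suc j)
    then have "\<not> ?P j" using not_less_Least[of j ?P] by simp
    then show ?thesis using Suc by simp
  qed (use h in simp)
  with P show "\<exists>k. 2 ^ k * R \<le> norm h \<and> norm h < 2 ^ k * (2 * R)" by blast
qed (use R in auto)

section \<open>Translates of a domain with smooth boundary\<close>

lemma has_derivative_mvt_convex:
  fixes f :: "'a::real_normed_vector \<Rightarrow> real"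
  assumes W: "convex W" "x \<in> W" "y \<in> W"
    and der: "\<And>u. u \<in> W \<Longrightarrow> (f has_derivative D u) (at u)"
  obtains u where "u \<in> W" "f y - f x = D u (y - x)"
proof -
  define g where "g t = x + t *\<^sub>R (y - x)" for t :: real
  have gW: "g t \<in> W" if "0 \<le> t" "t \<le> 1" for t
    using W that by (simp add: g_def algebra_simps convex_alt)
  have "((\<lambda>t. f (g t)) has_derivative (\<lambda>s. D (g t) (s *\<^sub>R (y - x)))) (at t within {0..1})"
    if "0 \<le> t" "t \<le> 1" for t
  proof -
    have "(g has_derivative (\<lambda>s. s *\<^sub>R (y - x))) (at t within {0..1})"
      unfolding g_def by (auto intro!: derivative_eq_intros)
    then show ?thesis using der[OF gW[OF that]] by (rule has_derivative_compose)
  qed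
  from mvt_very_simple[OF zero_le_one this]
  obtain t where "t \<in> {0..1}" "f (g 1) - f (g 0) = D (g t) ((1 - 0) *\<^sub>R (y - x))" by auto
  then show ?thesis using that[of "g t"] gW[of t] by (simp add: g_def)
qed

text \<open>
  A measure bound that needs no coordinates: a set with many pairwise disjoint translates inside
  \<open>W\<close> is small. It replaces integration along the normal direction in the estimate of a thin
  boundary layer.
\<close>

lemma emeasure_disjoint_translates_le:
  fixes S W :: "'a::euclidean_space set"
  assumes S: "S \<in> sets borel" and W: "W \<in> sets borel"
    and disj: "\<And>i j x. \<lbrakk>i < j; x \<in> S\<rbrakk> \<Longrightarrow> x + real (j - i) *\<^sub>R w \<notin> S"
    and sub: "\<And>j x. \<lbrakk>j < N; x \<in> S\<rbrakk> \<Longrightarrow> x + real j *\<^sub>R w \<in> W"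
  shows "ennreal (real N) * emeasure lborel S \<le> emeasure lborel W"
proof -
  define T where "T j = (+) (- (real j *\<^sub>R w)) -` S" for j :: nat
  have T: "T j \<in> sets borel" for j
    unfolding T_def by (intro measurable_sets_borel[OF _ S]) simp
  have emT: "emeasure lborel (T j) = emeasure lborel S" for j
  proof -
    have "emeasure lborel S = emeasure (distr lborel borel ((+) (- (real j *\<^sub>R w)))) S"
      by (simp add: lborel_distr_plus)
    also have "\<dots> = emeasure lborel (T j)"
      using S by (subst emeasure_distr) (simp_all add: T_def)
    finally show ?thesis by simp
  qed
  have "T i \<inter> T j = {}" if "i < j" for i j
  proof (rule ccontr)
    assume "T i \<inter> T j \<noteq> {}"
    then obtain y where y: "y - real i *\<^sub>R w \<in> S" "y - real j *\<^sub>R w \<in> S"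
      by (auto simp: T_def)
    have "y - real j *\<^sub>R w + real (j - i) *\<^sub>R w = y - real i *\<^sub>R w"
      using that by (simp add: of_nat_diff algebra_simps)
    then show False using disj[OF that y(2)] y(1) by metis
  qed
  then have d: "disjoint_family_on T {..<N}"
    unfolding disjoint_family_on_def by (metis inf_commute linorder_neqE_nat)
  have "ennreal (real N) * emeasure lborel S = (\<Sum>j<N. emeasure lborel (T j))"
    by (simp add: emT ennreal_of_nat_eq_real_of_nat)
  also have "\<dots> = emeasure lborel (\<Union>j<N. T j)"
    using d T by (intro sum_emeasure) auto
  also have "\<dots> \<le> emeasure lborel W"
  proof (intro emeasure_mono)
    show "(\<Union>j<N. T j) \<subseteq> W"
    proof
      fix y assume "y \<in> (\<Union>j<N. T j)"
      then obtain j where "j < N" "y - real j *\<^sub>R w \<in> S" by (auto simp: T_def)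
      from sub[OF this] show "y \<in> W" by simp
    qed
  qed (use W in simp)
  finally show ?thesis .
qed

text \<open>
  The boundary enters the volume estimate through the defining function to first order: near
  \<open>p\<close> its derivative is bounded below in one direction \<open>v\<close> and above in all directions.
\<close>

lemma regular_sublevel_neighbourhood:
  fixes \<Omega> :: "'a::euclidean_space set"
  assumes "smooth_boundary \<Omega>" "p \<in> frontier \<Omega>"
  obtains r c L :: real and v :: 'a and \<rho> :: "'a \<Rightarrow> real" and D :: "'a \<Rightarrow> 'a \<Rightarrow> real"
  where "r > 0" "c > 0" "L > 0"
    "\<And>x. x \<in> ball p r \<Longrightarrow> (\<rho> has_derivative D x) (at x)"
    "\<And>x. x \<in> ball p r \<Longrightarrow> D x v \<ge> c"
    "\<And>x h. x \<in> ball p r \<Longrightarrow> D x h \<le> L * norm h"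
    "\<And>x. x \<in> ball p r \<Longrightarrow> x \<in> \<Omega> \<longleftrightarrow> \<rho> x \<le> 0"
proof -
  obtain U and \<rho> :: "'a \<Rightarrow> real" where U: "open U" "p \<in> U" "smooth_on \<rho> U"
    "\<forall>x\<in>U. \<exists>v. frechet_derivative \<rho> (at x) v \<noteq> 0" "\<Omega> \<inter> U = {x \<in> U. \<rho> x \<le> 0}"
    using assms unfolding smooth_boundary_def by blast
  define D where "D x = frechet_derivative \<rho> (at x)" for x
  have "C_diff_on (Suc 0) \<rho> U" using U(3) unfolding smooth_on_def by blast
  then have C1: "\<forall>x\<in>U. \<rho> differentiable (at x)"
      "\<forall>v. continuous_on U (\<lambda>x. frechet_derivative \<rho> (at x) v)"
    by auto
  have der: "(\<rho> has_derivative D x) (at x)" if "x \<in> U" for x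
    using that C1(1) unfolding D_def by (simp add: frechet_derivative_works)
  have cont: "continuous_on U (\<lambda>x. D x v)" for v
    using C1(2) unfolding D_def by blast
  have lin: "linear (D x)" if "x \<in> U" for x
    using der[OF that] has_derivative_linear by blast
  obtain v0 where v0: "D p v0 \<noteq> 0" using U(2,4) unfolding D_def by blast
  define v where "v = (if D p v0 > 0 then v0 else - v0)"
  have Dv: "D p v > 0"
    using v0 linear_neg[OF lin[OF U(2)]] by (auto simp: v_def)
  have "isCont (\<lambda>x. D x v) p"
    using cont U(1,2) by (simp add: continuous_on_eq_continuous_at)
  then have "eventually (\<lambda>x. D x v > D p v / 2) (at p)"
    unfolding isCont_def using Dv by (intro order_tendstoD(1)) auto
  then obtain r1 where r1: "r1 > 0" "\<And>x. dist x p < r1 \<Longrightarrow> x \<noteq> p \<Longrightarrow> D x v > D p v / 2"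
    by (auto simp: eventually_at)
  obtain r2 where r2: "r2 > 0" "cball p r2 \<subseteq> U" using U(1,2) open_contains_cball by blast
  have "\<exists>M. \<forall>x\<in>cball p r2. \<bar>D x b\<bar> \<le> M" for b
  proof -
    have "bounded ((\<lambda>x. D x b) ` cball p r2)"
      using continuous_on_subset[OF cont r2(2)]
      by (intro compact_imp_bounded compact_continuous_image) auto
    then show ?thesis by (auto simp: bounded_iff)
  qed
  then obtain M where M: "\<And>b x. x \<in> cball p r2 \<Longrightarrow> \<bar>D x b\<bar> \<le> M b" by metis
  define L where "L = (\<Sum>b\<in>Basis. \<bar>M b\<bar>) + 1"
  define r where "r = min r1 r2"
  have sub: "ball p r \<subseteq> cball p r2" "ball p r \<subseteq> U" using r2 by (auto simp: r_def)
  show thesis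
  proof (rule that[of r "D p v / 2" L \<rho> D v])
    show "r > 0" using r1 r2 by (simp add: r_def)
    show "D p v / 2 > 0" using Dv by simp
    show "L > 0" unfolding L_def by (simp add: add_nonneg_pos sum_nonneg)
    show "(\<rho> has_derivative D x) (at x)" if "x \<in> ball p r" for x
      using der sub that by blast
    show "D x v \<ge> D p v / 2" if "x \<in> ball p r" for x
      using r1(2)[of x] that Dv by (cases "x = p") (auto simp: r_def dist_commute)
    show "x \<in> \<Omega> \<longleftrightarrow> \<rho> x \<le> 0" if "x \<in> ball p r" for x
      using U(5) sub that by blast
    show "D x h \<le> L * norm h" if "x \<in> ball p r" for x h
    proof -
      have "D x h = D x (\<Sum>b\<in>Basis. (h \<bullet> b) *\<^sub>R b)" by (simp add: euclidean_representation)
      also have "\<dots> = (\<Sum>b\<in>Basis. (h \<bullet> b) * D x b)"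
        using lin[of x] that sub by (subst linear_sum) (auto simp: linear_scale)
      also have "\<dots> \<le> (\<Sum>b\<in>Basis. norm h * \<bar>M b\<bar>)"
      proof (intro sum_mono)
        fix b :: 'a assume b: "b \<in> Basis"
        have "(h \<bullet> b) * D x b \<le> \<bar>h \<bullet> b\<bar> * \<bar>D x b\<bar>" by (metis abs_ge_self abs_mult)
        also have "\<dots> \<le> norm h * \<bar>M b\<bar>"
          using M[of x b] that sub Basis_le_norm[OF b] by (intro mult_mono) auto
        finally show "(h \<bullet> b) * D x b \<le> norm h * \<bar>M b\<bar>" .
      qed
      also have "\<dots> \<le> L * norm h"
        by (simp add: L_def sum_distrib_left[symmetric] algebra_simps)
      finally show ?thesis .
    qed
  qed
qed

lemma borel_exit_set:
  fixes \<Omega> :: "'a::euclidean_space set"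
  assumes "closed \<Omega>"
  shows "{x \<in> \<Omega> \<inter> ball p d. x + h \<notin> \<Omega>} \<in> sets borel"
proof -
  have "open ((\<lambda>x. x + h) -` (- \<Omega>))"
    using assms by (intro open_vimage continuous_intros) auto
  moreover have "{x \<in> \<Omega> \<inter> ball p d. x + h \<notin> \<Omega>} = \<Omega> \<inter> ball p d \<inter> (\<lambda>x. x + h) -` (- \<Omega>)" by auto
  ultimately show ?thesis using assms by auto
qed

text \<open>
  Points that leave \<open>\<Omega>\<close> under the translation by \<open>h\<close> satisfy
  \<open>- L * norm h < \<rho> x \<le> 0\<close>. Moving by \<open>\<tau> *\<^sub>R v\<close> with
  \<open>\<tau> = L * norm h / c\<close> raises \<open>\<rho>\<close> by at least \<open>L * norm h\<close>, so
  these translates of the layer are disjoint, and about \<open>1 / norm h\<close> of them fit into a fixed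
  ball.
\<close>

lemma emeasure_exit_set_local:
  fixes \<Omega> :: "'a::euclidean_space set"
  assumes "smooth_boundary \<Omega>" "closed \<Omega>" "p \<in> frontier \<Omega>"
  obtains \<delta> C where "\<delta> > 0" "C \<ge> 0"
    "\<And>h. norm h < \<delta> \<Longrightarrow> emeasure lborel {x \<in> \<Omega> \<inter> ball p \<delta>. x + h \<notin> \<Omega>} \<le> ennreal (C * norm h)"
proof -
  obtain r c L :: real and v :: 'a and \<rho> D where r: "r > 0" and c: "c > 0" and L: "L > 0"
    and der: "\<And>x. x \<in> ball p r \<Longrightarrow> (\<rho> has_derivative D x) (at x)"
    and Dv: "\<And>x. x \<in> ball p r \<Longrightarrow> D x v \<ge> c"
    and DL: "\<And>x h. x \<in> ball p r \<Longrightarrow> D x h \<le> L * norm h"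
    and sublevel: "\<And>x. x \<in> ball p r \<Longrightarrow> x \<in> \<Omega> \<longleftrightarrow> \<rho> x \<le> 0"
    using regular_sublevel_neighbourhood[OF assms(1,3)] by metis
  have lin: "linear (D x)" if "x \<in> ball p r" for x
    using der[OF that] has_derivative_linear by blast
  have v: "v \<noteq> 0"
    using Dv[of p] c r linear_0[OF lin[of p]] by auto
  define \<delta> where "\<delta> = r / 2"
  define m where "m = measure lborel (ball p r)"
  have m: "emeasure lborel (ball p r) = ennreal m" "m \<ge> 0"
    using emeasure_bounded_finite[OF bounded_ball, of p r]
    by (auto simp: m_def emeasure_eq_ennreal_measure)
  have bound: "emeasure lborel {x \<in> \<Omega> \<inter> ball p \<delta>. x + h \<notin> \<Omega>} \<le> ennreal (m * L * norm v / (c * \<delta>) * norm h)"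
    if h: "norm h < \<delta>" for h
  proof (cases "h = 0")
    case False
    define E where "E = {x \<in> \<Omega> \<inter> ball p \<delta>. x + h \<notin> \<Omega>}"
    define \<tau> where "\<tau> = L * norm h / c"
    \<comment> \<open>as many translates as keep the ball of radius \<open>\<delta>\<close> inside the one of radius \<open>r = 2 * \<delta>\<close>\<close>
    define N where "N = nat \<lfloor>\<delta> / (\<tau> * norm v)\<rfloor> + 1"
    have \<delta>: "\<delta> > 0" using r by (simp add: \<delta>_def)
    have \<tau>: "\<tau> > 0" using L c False by (simp add: \<tau>_def)
    have N: "\<delta> / (\<tau> * norm v) \<le> real N" unfolding N_def by linarith
    have E_rho: "x \<in> ball p r" "\<rho> x \<le> 0" "\<rho> x > - L * norm h" if "x \<in> E" for x
    proof -
      show x: "x \<in> ball p r" using that \<delta> by (auto simp: E_def \<delta>_def)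
      show "\<rho> x \<le> 0" using that x sublevel by (auto simp: E_def)
      have xh: "x + h \<in> ball p r"
      proof -
        have "dist p (x + h) \<le> dist p x + norm h"
          using dist_triangle[of p "x + h" x] by (simp add: dist_norm)
        then show ?thesis using that h by (simp add: E_def \<delta>_def)
      qed
      have "\<rho> (x + h) > 0" using that xh sublevel by (auto simp: E_def)
      moreover obtain u where "u \<in> ball p r" "\<rho> (x + h) - \<rho> x = D u (x + h - x)"
        using has_derivative_mvt_convex[OF convex_ball x xh der] by metis
      ultimately show "\<rho> x > - L * norm h" using DL[of u h] by simp
    qed
    have "ennreal (real N) * emeasure lborel E \<le> emeasure lborel (ball p r)"
    proof (rule emeasure_disjoint_translates_le[where w = "\<tau> *\<^sub>R v"])
      show "E \<in> sets borel" unfolding E_def using assms(2) by (rule borel_exit_set)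
      show "ball p r \<in> sets borel" by simp
      show "x + real j *\<^sub>R \<tau> *\<^sub>R v \<in> ball p r" if "j < N" "x \<in> E" for j x
      proof -
        have "real j \<le> \<delta> / (\<tau> * norm v)" using that(1) \<delta> \<tau> v unfolding N_def
          by (simp add: le_nat_iff less_Suc_eq_le le_floor_iff)
        then have "real j * (\<tau> * norm v) \<le> \<delta>" using \<tau> v by (simp add: field_simps)
        then have "norm (real j *\<^sub>R \<tau> *\<^sub>R v) \<le> \<delta>" using \<tau> by (simp add: mult_ac)
        moreover have "dist p (x + real j *\<^sub>R \<tau> *\<^sub>R v) \<le> dist p x + norm (real j *\<^sub>R \<tau> *\<^sub>R v)"
          using dist_triangle[of p "x + real j *\<^sub>R \<tau> *\<^sub>R v" x] by (simp add: dist_norm)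
        moreover have "dist p x < \<delta>" using that(2) by (simp add: E_def)
        ultimately show ?thesis by (simp add: \<delta>_def)
      qed
      show "x + real (j - i) *\<^sub>R \<tau> *\<^sub>R v \<notin> E" if "i < j" "x \<in> E" for i j x
      proof
        define y where "y = x + real (j - i) *\<^sub>R \<tau> *\<^sub>R v"
        assume "x + real (j - i) *\<^sub>R \<tau> *\<^sub>R v \<in> E"
        then have y: "y \<in> E" by (simp add: y_def)
        note x = \<open>x \<in> E\<close>
        obtain u where u: "u \<in> ball p r" "\<rho> y - \<rho> x = D u (y - x)"
          using has_derivative_mvt_convex[OF convex_ball E_rho(1)[OF x] E_rho(1)[OF y] der] by metis
        have "\<tau> * c \<le> real (j - i) * (\<tau> * D u v)"
        proof -
          have "1 * (\<tau> * c) \<le> real (j - i) * (\<tau> * D u v)"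
            using that(1) \<tau> c Dv[OF u(1)] by (intro mult_mono) auto
          then show ?thesis by simp
        qed
        also have "\<dots> = \<rho> y - \<rho> x"
          unfolding u(2) using lin[OF u(1)] by (simp add: y_def linear_scale)
        finally have "L * norm h \<le> \<rho> y - \<rho> x" using c by (simp add: \<tau>_def)
        then show False using E_rho(2)[OF y] E_rho(3)[OF that(2)] by simp
      qed
    qed
    then have le: "ennreal (real N) * emeasure lborel E \<le> ennreal m" by (simp add: m)
    have "emeasure lborel E \<le> emeasure lborel (ball p r)"
      using E_rho(1) by (intro emeasure_mono) auto
    then obtain e where e: "emeasure lborel E = ennreal e" "e \<ge> 0"
      using m(1) by (metis ennreal_cases neq_top_trans ennreal_neq_top)
    have "real N * e \<le> m" using le e m(2) by (simp add: ennreal_mult[symmetric])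
    then have "\<delta> / (\<tau> * norm v) * e \<le> m" using mult_right_mono[OF N e(2)] by linarith
    then have "e \<le> m * (\<tau> * norm v) / \<delta>" using \<delta> \<tau> v by (simp add: field_simps)
    then show ?thesis unfolding E_def[symmetric] e(1) \<tau>_def
      by (intro ennreal_leI) (simp add: field_simps)
  next
    case True
    then have "{x \<in> \<Omega> \<inter> ball p \<delta>. x + h \<notin> \<Omega>} = {}" by auto
    then show ?thesis by (metis emeasure_empty zero_le)
  qed
  show thesis
    using that[of \<delta> "m * L * norm v / (c * \<delta>)"] bound r c L m(2) by (simp add: \<delta>_def)
qed

text \<open>
  The quantitative form of finite perimeter. For small \<open>h\<close> the segment from \<open>x\<close> to
  \<open>x + h\<close> meets the compact frontier, so finitely many local estimates suffice; for large
  \<open>h\<close> the measure of \<open>\<Omega>\<close> is itself at most a multiple of \<open>norm h\<close>.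
\<close>

lemma emeasure_exit_set_le:
  fixes \<Omega> :: "'a::euclidean_space set"
  assumes "compact_smooth_domain \<Omega>"
  obtains C where "C \<ge> 0"
    "\<And>h. emeasure lborel {x \<in> \<Omega>. x + h \<notin> \<Omega>} \<le> ennreal (C * norm h)"
proof -
  have comp: "compact \<Omega>" and smooth: "smooth_boundary \<Omega>"
    using assms by (auto simp: compact_smooth_domain_def)
  have cl: "closed \<Omega>" using comp compact_imp_closed by blast
  define E where "E h = {x \<in> \<Omega>. x + h \<notin> \<Omega>}" for h
  have "\<forall>p\<in>frontier \<Omega>. \<exists>\<delta> C. \<delta> > 0 \<and> C \<ge> 0 \<and>
      (\<forall>h. norm h < \<delta> \<longrightarrow> emeasure lborel {x \<in> \<Omega> \<inter> ball p \<delta>. x + h \<notin> \<Omega>} \<le> ennreal (C * norm h))"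
    using emeasure_exit_set_local[OF smooth cl] by metis
  from bchoice[OF this] obtain \<delta> where "\<forall>p\<in>frontier \<Omega>. \<exists>C. \<delta> p > 0 \<and> C \<ge> 0 \<and>
      (\<forall>h. norm h < \<delta> p \<longrightarrow> emeasure lborel {x \<in> \<Omega> \<inter> ball p (\<delta> p). x + h \<notin> \<Omega>} \<le> ennreal (C * norm h))"
    by blast
  from bchoice[OF this] obtain C where dC: "\<And>p. p \<in> frontier \<Omega> \<Longrightarrow> \<delta> p > 0"
      "\<And>p. p \<in> frontier \<Omega> \<Longrightarrow> C p \<ge> 0"
    and loc: "\<And>p h. p \<in> frontier \<Omega> \<Longrightarrow> norm h < \<delta> p \<Longrightarrow>
       emeasure lborel {x \<in> \<Omega> \<inter> ball p (\<delta> p). x + h \<notin> \<Omega>} \<le> ennreal (C p * norm h)"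
    by blast
  obtain F where F: "F \<subseteq> frontier \<Omega>" "finite F" "frontier \<Omega> \<subseteq> (\<Union>p\<in>F. ball p (\<delta> p / 2))"
  proof (rule compactE_image[of "frontier \<Omega>" "frontier \<Omega>" "\<lambda>p. ball p (\<delta> p / 2)"])
    show "compact (frontier \<Omega>)" using comp by (rule compact_frontier)
    show "frontier \<Omega> \<subseteq> (\<Union>p\<in>frontier \<Omega>. ball p (\<delta> p / 2))" using dC by force
  qed auto
  define r0 where "r0 = Min (insert 1 ((\<lambda>p. \<delta> p / 2) ` F))"
  have r0: "r0 > 0" unfolding r0_def using F(1,2) dC(1) by (subst Min_gr_iff) auto
  have r0_le: "r0 \<le> \<delta> p / 2" if "p \<in> F" for p
    unfolding r0_def using F(2) that by (intro Min_le) auto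
  define m where "m = measure lborel \<Omega>"
  have m: "emeasure lborel \<Omega> = ennreal m" "m \<ge> 0"
    using emeasure_bounded_finite[OF compact_imp_bounded[OF comp]]
    by (auto simp: m_def emeasure_eq_ennreal_measure)
  have meas: "{x \<in> \<Omega> \<inter> ball p d. x + h \<notin> \<Omega>} \<in> sets borel" for p d h
    using cl by (rule borel_exit_set)
  have sumC: "(\<Sum>p\<in>F. C p) \<ge> 0" using dC(2) F(1) by (intro sum_nonneg) auto
  show thesis
  proof (rule that[of "(\<Sum>p\<in>F. C p) + m / r0"])
    show "0 \<le> sum C F + m / r0" using sumC m r0 by simp
    fix h :: 'a
    show "emeasure lborel {x \<in> \<Omega>. x + h \<notin> \<Omega>} \<le> ennreal ((sum C F + m / r0) * norm h)"
    proof (cases "norm h < r0")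
      case True
      have "E h \<subseteq> (\<Union>p\<in>F. {x \<in> \<Omega> \<inter> ball p (\<delta> p). x + h \<notin> \<Omega>})"
      proof
        fix x assume x: "x \<in> E h"
        have "closed_segment x (x + h) \<inter> frontier \<Omega> \<noteq> {}"
          using x by (intro connected_Int_frontier) (auto simp: E_def)
        then obtain q where q: "q \<in> closed_segment x (x + h)" "q \<in> frontier \<Omega>" by blast
        then obtain p where p: "p \<in> F" "q \<in> ball p (\<delta> p / 2)" using F(3) by blast
        have "dist q x \<le> norm h"
          using segment_bound(1)[OF q(1)] by (simp add: dist_norm)
        moreover have "dist p x \<le> dist p q + dist q x" by (rule dist_triangle)
        ultimately have "dist p x < \<delta> p" using p(2) r0_le[OF p(1)] True by simp
        then show "x \<in> (\<Union>p\<in>F. {x \<in> \<Omega> \<inter> ball p (\<delta> p). x + h \<notin> \<Omega>})"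
          using x p(1) by (auto simp: E_def)
      qed
      then have "emeasure lborel (E h) \<le> emeasure lborel (\<Union>p\<in>F. {x \<in> \<Omega> \<inter> ball p (\<delta> p). x + h \<notin> \<Omega>})"
        using F(2) meas by (intro emeasure_mono) (auto intro!: sets.finite_UN)
      also have "\<dots> \<le> (\<Sum>p\<in>F. emeasure lborel {x \<in> \<Omega> \<inter> ball p (\<delta> p). x + h \<notin> \<Omega>})"
        using F(2) meas by (intro emeasure_subadditive_finite) auto
      also have "\<dots> \<le> (\<Sum>p\<in>F. ennreal (C p * norm h))"
      proof (intro sum_mono loc)
        fix p assume p: "p \<in> F"
        then show "p \<in> frontier \<Omega>" using F(1) by blast
        then show "norm h < \<delta> p" using r0_le[OF p] True dC(1)[of p] by simp
      qed
      also have "\<dots> = ennreal (\<Sum>p\<in>F. C p * norm h)"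
        using dC(2) F(1) by (intro sum_ennreal) auto
      also have "\<dots> \<le> ennreal ((sum C F + m / r0) * norm h)"
        using m r0 by (intro ennreal_leI) (simp add: sum_distrib_right[symmetric] distrib_right)
      finally show ?thesis by (simp add: E_def)
    next
      case False
      have "emeasure lborel (E h) \<le> emeasure lborel \<Omega>"
        using cl by (intro emeasure_mono) (auto simp: E_def)
      also have "\<dots> \<le> ennreal ((sum C F + m / r0) * norm h)"
      proof -
        have "m \<le> m / r0 * norm h"
          using False r0 m(2) by (simp add: field_simps mult_left_mono)
        also have "\<dots> \<le> (sum C F + m / r0) * norm h"
          using sumC by (intro mult_right_mono) auto
        finally show ?thesis by (simp add: m(1) ennreal_leI)
      qed
      finally show ?thesis by (simp add: E_def)
    qed
  qed
qed

section \<open>Riesz integrals over sets of pairs\<close>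

text \<open>
  The absolute version of the Riesz integral over an arbitrary set of pairs: its finiteness at
  \<open>Re z\<close> means integrability of \<open>riesz_kernel z\<close>.
\<close>

definition riesz_mass :: "('a::euclidean_space \<times> 'a) set \<Rightarrow> real \<Rightarrow> ennreal" where
  "riesz_mass S s = (\<integral>\<^sup>+p. ennreal (norm (fst p - snd p) powr s) * indicator S p \<partial>lborel)"

text \<open>
  A region described by the displacement alone: on it the integral over pairs factors, and dilating
  \<open>D\<close> is a linear change of variables that fixes the first point.
\<close>

definition displaced :: "'a::euclidean_space set \<Rightarrow> 'a set \<Rightarrow> ('a \<times> 'a) set" where
  "displaced \<Omega> D = {p. fst p \<in> \<Omega> \<and> snd p - fst p \<in> D}"

abbreviation riesz_integral :: "('a::euclidean_space \<times> 'a) set \<Rightarrow> complex \<Rightarrow> complex" where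
  "riesz_integral S z \<equiv> set_lebesgue_integral lborel S (riesz_kernel z)"

text \<open>
  The restriction to \<open>S\<close> is moved into the base of the power, so that a set integral of the
  kernel becomes an integral of powers of one function.
\<close>

definition cut_distance :: "('a::euclidean_space \<times> 'a) set \<Rightarrow> 'a \<times> 'a \<Rightarrow> real" where
  "cut_distance S p = indicator S p * norm (fst p - snd p)"

lemma cut_distance_nonneg: "cut_distance S p \<ge> 0"
  by (simp add: cut_distance_def)

lemma borel_measurable_cut_distance:
  assumes [measurable]: "S \<in> sets borel"
  shows "cut_distance S \<in> borel_measurable lborel"
proof -
  have [measurable]: "(\<lambda>p::'a \<times> 'a. norm (fst p - snd p)) \<in> borel_measurable borel"
    by (intro borel_measurable_continuous_onI continuous_intros)
  show ?thesis unfolding cut_distance_def by measurable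
qed

lemma scaleR_indicator_riesz_kernel:
  "indicator S p *\<^sub>R riesz_kernel z p = complex_of_real (cut_distance S p) powr z"
  by (simp add: riesz_kernel_def cut_distance_def indicator_def case_prod_unfold)

lemma integrable_cut_distance_powr:
  assumes S: "S \<in> sets borel" and fin: "riesz_mass S s < \<infinity>"
  shows "integrable lborel (\<lambda>p. cut_distance S p powr s)"
proof (rule integrableI_nonneg)
  show "(\<lambda>p. cut_distance S p powr s) \<in> borel_measurable lborel"
    using borel_measurable_cut_distance[OF S] by measurable
  have "(\<integral>\<^sup>+p. ennreal (cut_distance S p powr s) \<partial>lborel) = riesz_mass S s"
    unfolding riesz_mass_def by (intro nn_integral_cong) (auto simp: cut_distance_def indicator_def)
  then show "(\<integral>\<^sup>+p. ennreal (cut_distance S p powr s) \<partial>lborel) < \<infinity>" using fin by simp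
qed auto

lemma set_integrable_riesz_kernel:
  assumes S: "S \<in> sets borel" and fin: "riesz_mass S (Re z) < \<infinity>"
  shows "set_integrable lborel S (riesz_kernel z)"
  unfolding set_integrable_def scaleR_indicator_riesz_kernel
  by (intro integrable_of_real_powr borel_measurable_cut_distance cut_distance_nonneg
      integrable_cut_distance_powr S fin)

lemma holomorphic_on_riesz_integral:
  assumes S: "S \<in> sets borel" and X: "open X"
    and fin: "\<And>s. s \<in> X \<Longrightarrow> riesz_mass S s < \<infinity>"
  shows "riesz_integral S holomorphic_on {z. Re z \<in> X}"
  unfolding set_lebesgue_integral_def scaleR_indicator_riesz_kernel
  by (intro holomorphic_on_integral_powr borel_measurable_cut_distance cut_distance_nonneg
      integrable_cut_distance_powr S X fin)

text \<open>
  A bound \<open>C * norm h powr k\<close> on the fibres over the displacement \<open>h\<close> improves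
  convergence near the diagonal by \<open>k\<close>. The case \<open>k = 1\<close> is what carries the
  fractional perimeter past the exponent \<open>- DIM('a)\<close>. Displacement \<open>0\<close> is excluded since
  \<open>0 powr 0 = 0\<close>.
\<close>

lemma riesz_mass_le:
  fixes S :: "('a::euclidean_space \<times> 'a) set"
  assumes S[measurable]: "S \<in> sets borel" and D[measurable]: "D \<in> sets borel" and C: "C \<ge> 0"
    and fibre: "\<And>h. h \<noteq> 0 \<Longrightarrow>
       emeasure lborel {x. (x, x + h) \<in> S} \<le> ennreal (C * norm h powr k) * indicator D h"
  shows "riesz_mass S s \<le> ennreal C * (\<integral>\<^sup>+h. ennreal (norm h powr (s + k)) * indicator D h \<partial>lborel)"
proof -
  have [measurable]: "(\<lambda>p::'a \<times> 'a. norm (fst p - snd p)) \<in> borel_measurable borel"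
    by (intro borel_measurable_continuous_onI continuous_intros)
  have "riesz_mass S s = (\<integral>\<^sup>+h. \<integral>\<^sup>+x. ennreal (norm h powr s) * indicator S (x, x + h) \<partial>lborel \<partial>lborel)"
    unfolding riesz_mass_def by (subst nn_integral_lborel_shear) simp_all
  also have "\<dots> \<le> (\<integral>\<^sup>+h. ennreal C * (ennreal (norm h powr (s + k)) * indicator D h) \<partial>lborel)"
  proof (rule nn_integral_mono)
    fix h :: 'a
    show "(\<integral>\<^sup>+x. ennreal (norm h powr s) * indicator S (x, x + h) \<partial>lborel)
        \<le> ennreal C * (ennreal (norm h powr (s + k)) * indicator D h)"
    proof (cases "h = 0")
      case False
      have "(\<lambda>x. (x, x + h)) -` S \<in> sets borel"
        by (intro measurable_sets_borel[OF _ S] borel_measurable_continuous_onI continuous_intros)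
      then have meas: "{x. (x, x + h) \<in> S} \<in> sets lborel" by (simp add: vimage_def)
      have "(\<integral>\<^sup>+x. ennreal (norm h powr s) * indicator S (x, x + h) \<partial>lborel) =
          (\<integral>\<^sup>+x. ennreal (norm h powr s) * indicator {x. (x, x + h) \<in> S} x \<partial>lborel)"
        by (intro nn_integral_cong) (auto simp: indicator_def)
      also have "\<dots> = ennreal (norm h powr s) * emeasure lborel {x. (x, x + h) \<in> S}"
        using meas by (rule nn_integral_cmult_indicator)
      also have "\<dots> \<le> ennreal (norm h powr s) * (ennreal (C * norm h powr k) * indicator D h)"
        using fibre[OF False] by (rule mult_left_mono) simp
      also have "\<dots> = ennreal C * (ennreal (norm h powr (s + k)) * indicator D h)"
        using C by (simp add: powr_add ennreal_mult mult_ac)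
      finally show ?thesis .
    qed simp
  qed
  also have "\<dots> = ennreal C * (\<integral>\<^sup>+h. ennreal (norm h powr (s + k)) * indicator D h \<partial>lborel)"
    by (intro nn_integral_cmult) measurable
  finally show ?thesis .
qed

lemma borel_displaced:
  assumes \<Omega>[measurable]: "\<Omega> \<in> sets borel" and D[measurable]: "D \<in> sets borel"
  shows "displaced \<Omega> D \<in> sets borel"
proof -
  have "fst -` \<Omega> \<in> sets (borel :: ('a \<times> 'a) measure)"
    by (intro measurable_sets_borel[OF _ \<Omega>] borel_measurable_continuous_onI continuous_intros)
  moreover have "(\<lambda>p::'a \<times> 'a. snd p - fst p) -` D \<in> sets borel"
    by (intro measurable_sets_borel[OF _ D] borel_measurable_continuous_onI continuous_intros)
  moreover have "displaced \<Omega> D = fst -` \<Omega> \<inter> (\<lambda>p. snd p - fst p) -` D"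
    by (auto simp: displaced_def)
  ultimately show ?thesis by simp
qed

lemma riesz_mass_displaced_finite:
  fixes \<Omega> D :: "'a::euclidean_space set"
  assumes \<Omega>: "compact \<Omega>" and D: "D \<in> sets borel"
    and fin: "(\<integral>\<^sup>+h. ennreal (norm h powr s) * indicator D h \<partial>lborel) < \<infinity>"
  shows "riesz_mass (displaced \<Omega> D) s < \<infinity>"
proof -
  have m: "emeasure lborel \<Omega> = ennreal (measure lborel \<Omega>)"
    using emeasure_bounded_finite[OF compact_imp_bounded[OF \<Omega>]]
    by (auto simp: emeasure_eq_ennreal_measure)
  have "riesz_mass (displaced \<Omega> D) s \<le>
     ennreal (measure lborel \<Omega>) * (\<integral>\<^sup>+h. ennreal (norm h powr (s + 0)) * indicator D h \<partial>lborel)"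
  proof (rule riesz_mass_le)
    show "displaced \<Omega> D \<in> sets borel" using \<Omega> D by (intro borel_displaced) (auto simp: borel_compact)
    fix h :: 'a assume "h \<noteq> 0"
    then show "emeasure lborel {x. (x, x + h) \<in> displaced \<Omega> D}
        \<le> ennreal (measure lborel \<Omega> * norm h powr 0) * indicator D h"
      by (auto simp: displaced_def indicator_def m)
  qed (use D in auto)
  then show ?thesis using fin by (auto simp: ennreal_mult_less_top intro: order.strict_trans1)
qed

lemma riesz_integral_displaced_scale:
  fixes \<Omega> D D' :: "'a::euclidean_space set"
  assumes \<Omega>: "\<Omega> \<in> sets borel" and D': "D' \<in> sets borel" and c: "c > 0"
    and DD': "\<And>h. c *\<^sub>R h \<in> D' \<longleftrightarrow> h \<in> D"
  shows "riesz_integral (displaced \<Omega> D') z =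
    complex_of_real c powr (z + of_nat DIM('a)) * riesz_integral (displaced \<Omega> D) z"
proof -
  define T where "T = (\<lambda>p::'a \<times> 'a. (fst p, fst p + c *\<^sub>R (snd p - fst p)))"
  define f where "f = (\<lambda>p. complex_of_real (cut_distance (displaced \<Omega> D') p) powr z)"
  have T: "T \<in> borel_measurable borel"
    unfolding T_def by (intro borel_measurable_continuous_onI continuous_intros)
  have f: "f \<in> borel_measurable borel"
    using borel_measurable_of_real_powr[OF borel_measurable_cut_distance[OF borel_displaced[OF \<Omega> D']] cut_distance_nonneg]
    by (simp add: f_def)
  have fT: "f (T p) = complex_of_real c powr z * (complex_of_real (cut_distance (displaced \<Omega> D) p) powr z)" for p
  proof -
    have "norm (fst (T p) - snd (T p)) = c * norm (fst p - snd p)"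
      using c by (simp add: T_def norm_minus_commute)
    moreover have "T p \<in> displaced \<Omega> D' \<longleftrightarrow> p \<in> displaced \<Omega> D"
      by (simp add: displaced_def T_def DD')
    ultimately have "cut_distance (displaced \<Omega> D') (T p) = c * cut_distance (displaced \<Omega> D) p"
      by (simp add: cut_distance_def indicator_def)
    then show ?thesis
      using c cut_distance_nonneg[of "displaced \<Omega> D" p] by (simp add: f_def powr_times_real)
  qed
  have "riesz_integral (displaced \<Omega> D') z = integral\<^sup>L lborel f"
    by (simp add: f_def set_lebesgue_integral_def scaleR_indicator_riesz_kernel)
  also have "\<dots> = integral\<^sup>L (density (distr lborel borel T) (\<lambda>_. ennreal (c ^ DIM('a)))) f"
    unfolding T_def by (subst lborel_pair_dilation[OF c]) simp
  also have "\<dots> = (\<integral>p. c ^ DIM('a) *\<^sub>R f p \<partial>distr lborel borel T)"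
    using f c by (intro integral_density) auto
  also have "\<dots> = (\<integral>p. c ^ DIM('a) *\<^sub>R f (T p) \<partial>lborel)"
    using f T by (intro integral_distr) auto
  also have "\<dots> = of_real (c ^ DIM('a)) * complex_of_real c powr z * riesz_integral (displaced \<Omega> D) z"
    unfolding set_lebesgue_integral_def scaleR_indicator_riesz_kernel
    by (simp add: fT scaleR_conv_of_real mult_ac)
  also have "of_real (c ^ DIM('a)) * complex_of_real c powr z = complex_of_real c powr (z + of_nat DIM('a))"
    using c by (simp add: powr_add powr_nat')
  finally show ?thesis .
qed

lemma riesz_integral_Un:
  assumes "A \<inter> B = {}" "A \<in> sets borel" "B \<in> sets borel"
    and "riesz_mass A (Re z) < \<infinity>" "riesz_mass B (Re z) < \<infinity>"
  shows "riesz_integral (A \<union> B) z = riesz_integral A z + riesz_integral B z"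
  using assms by (intro set_integral_Un set_integrable_riesz_kernel) auto

lemma riesz_mass_mono: "A \<subseteq> B \<Longrightarrow> riesz_mass A s \<le> riesz_mass B s"
  unfolding riesz_mass_def by (intro nn_integral_mono mult_left_mono) (auto simp: indicator_def)

lemma riesz_mass_near_finite:
  fixes \<Omega> :: "'a::euclidean_space set"
  assumes "compact \<Omega>" "s > - real DIM('a)"
  shows "riesz_mass (displaced \<Omega> (ball 0 R)) s < \<infinity>"
  using assms nn_integral_norm_powr_ball_finite[OF assms(2), of R]
  by (intro riesz_mass_displaced_finite) auto

lemma riesz_mass_far_finite:
  fixes \<Omega> :: "'a::euclidean_space set"
  assumes "compact \<Omega>" "s < - real DIM('a)" "R > 0"
  shows "riesz_mass (displaced \<Omega> (- ball 0 R)) s < \<infinity>"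
  using assms nn_integral_norm_powr_outside_finite[OF assms(2,3)]
  by (intro riesz_mass_displaced_finite) auto

lemma riesz_mass_annulus_finite:
  fixes \<Omega> :: "'a::euclidean_space set"
  assumes "compact \<Omega>" "R > 0"
  shows "riesz_mass (displaced \<Omega> (ball 0 R' - ball 0 R)) s < \<infinity>"
proof (rule riesz_mass_displaced_finite[OF assms(1)])
  show "ball 0 R' - ball 0 R \<in> sets borel" by simp
  have "ball 0 R' - ball 0 R = {h::'a. R \<le> norm h \<and> norm h < R'}"
    by auto
  then show "(\<integral>\<^sup>+(h::'a). ennreal (norm h powr s) * indicator (ball 0 R' - ball 0 R) h \<partial>lborel) < \<infinity>"
    using shell_integral_finite[OF assms(2), of s R', where 'a='a] by (simp add: shell_integral_def)
qed

text \<open>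
  The annulus is the difference of two balls that are dilates of each other. This continues the
  integral over the ball, which converges only to the right of \<open>- DIM('a)\<close>, by the annulus
  integral, which is entire, divided by \<open>2 powr (z + DIM('a)) - 1\<close>.
\<close>

lemma riesz_integral_annulus_near:
  fixes \<Omega> :: "'a::euclidean_space set"
  assumes \<Omega>: "compact \<Omega>" and R: "R > 0" and z: "Re z > - real DIM('a)"
  shows "riesz_integral (displaced \<Omega> (ball 0 (2 * R) - ball 0 R)) z =
    (2 powr (z + of_nat DIM('a)) - 1) * riesz_integral (displaced \<Omega> (ball 0 R)) z"
proof -
  have b: "\<Omega> \<in> sets borel" using \<Omega> by (rule borel_compact)
  have "displaced \<Omega> (ball 0 (2 * R)) =
      displaced \<Omega> (ball 0 (2 * R) - ball 0 R) \<union> displaced \<Omega> (ball 0 R)"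
    using R by (auto simp: displaced_def)
  then have "riesz_integral (displaced \<Omega> (ball 0 (2 * R))) z =
      riesz_integral (displaced \<Omega> (ball 0 (2 * R) - ball 0 R)) z + riesz_integral (displaced \<Omega> (ball 0 R)) z"
    using riesz_mass_near_finite[OF \<Omega> z] riesz_mass_annulus_finite[OF \<Omega> R]
    by (simp only:) (intro riesz_integral_Un borel_displaced b; auto simp: displaced_def)
  moreover have "riesz_integral (displaced \<Omega> (ball 0 (2 * R))) z =
      complex_of_real 2 powr (z + of_nat DIM('a)) * riesz_integral (displaced \<Omega> (ball 0 R)) z"
    by (rule riesz_integral_displaced_scale) (use b in auto)
  ultimately show ?thesis by (simp add: algebra_simps)
qed

text \<open>
  The same annulus is also the difference of two exteriors of balls, in the opposite order. The sign
  change is the sign in front of the fractional perimeter.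
\<close>

lemma riesz_integral_annulus_far:
  fixes \<Omega> :: "'a::euclidean_space set"
  assumes \<Omega>: "compact \<Omega>" and R: "R > 0" and z: "Re z < - real DIM('a)"
  shows "riesz_integral (displaced \<Omega> (ball 0 (2 * R) - ball 0 R)) z =
    - (2 powr (z + of_nat DIM('a)) - 1) * riesz_integral (displaced \<Omega> (- ball 0 R)) z"
proof -
  have b: "\<Omega> \<in> sets borel" using \<Omega> by (rule borel_compact)
  have "displaced \<Omega> (- ball 0 R) =
      displaced \<Omega> (ball 0 (2 * R) - ball 0 R) \<union> displaced \<Omega> (- ball 0 (2 * R))"
    using R by (auto simp: displaced_def)
  then have "riesz_integral (displaced \<Omega> (- ball 0 R)) z =
      riesz_integral (displaced \<Omega> (ball 0 (2 * R) - ball 0 R)) z + riesz_integral (displaced \<Omega> (- ball 0 (2 * R))) z"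
    using riesz_mass_far_finite[OF \<Omega> z, of "2 * R"] R riesz_mass_annulus_finite[OF \<Omega> R]
    by (simp only:) (intro riesz_integral_Un borel_displaced b; auto simp: displaced_def)
  moreover have "riesz_integral (displaced \<Omega> (- ball 0 (2 * R))) z =
      complex_of_real 2 powr (z + of_nat DIM('a)) * riesz_integral (displaced \<Omega> (- ball 0 R)) z"
    by (rule riesz_integral_displaced_scale) (use b in auto)
  ultimately show ?thesis by (simp add: algebra_simps)
qed

text \<open>
  The zeros of the denominator all lie on the line that separates the two half planes.
\<close>

lemma two_powr_neq_1:
  assumes "Re z \<noteq> - real n"
  shows "2 powr (z + of_nat n) \<noteq> (1::complex)"
proof
  assume "2 powr (z + of_nat n) = (1::complex)"
  then have "norm (2 powr (z + of_nat n) :: complex) = 1" by simp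
  then have "2 powr (Re z + real n) = 1" by (simp add: norm_powr_real_powr)
  then show False using assms by simp
qed

lemma riesz_mass_exit_finite:
  fixes \<Omega> :: "'a::euclidean_space set"
  assumes \<Omega>: "compact_smooth_domain \<Omega>" and s: "s > - real DIM('a) - 1"
  shows "riesz_mass (\<Omega> \<times> (- \<Omega>) \<inter> displaced \<Omega> (ball 0 R)) s < \<infinity>"
proof -
  have comp: "compact \<Omega>" using \<Omega> by (simp add: compact_smooth_domain_def)
  have b: "\<Omega> \<in> sets borel" using comp by (rule borel_compact)
  obtain C where C: "C \<ge> 0" "\<And>h. emeasure lborel {x \<in> \<Omega>. x + h \<notin> \<Omega>} \<le> ennreal (C * norm h)"
    using emeasure_exit_set_le[OF \<Omega>] by blast
  have "riesz_mass (\<Omega> \<times> (- \<Omega>) \<inter> displaced \<Omega> (ball 0 R)) s \<le>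
     ennreal C * (\<integral>\<^sup>+(h::'a). ennreal (norm h powr (s + 1)) * indicator (ball 0 R) h \<partial>lborel)"
  proof (rule riesz_mass_le)
    show "\<Omega> \<times> (- \<Omega>) \<inter> displaced \<Omega> (ball 0 R) \<in> sets borel"
      using b by (intro sets.Int borel_displaced borel_Times) auto
    fix h :: 'a
    have "{x. (x, x + h) \<in> \<Omega> \<times> (- \<Omega>) \<inter> displaced \<Omega> (ball 0 R)} =
        (if norm h < R then {x \<in> \<Omega>. x + h \<notin> \<Omega>} else {})"
      by (auto simp: displaced_def)
    then show "emeasure lborel {x. (x, x + h) \<in> \<Omega> \<times> (- \<Omega>) \<inter> displaced \<Omega> (ball 0 R)}
        \<le> ennreal (C * norm h powr 1) * indicator (ball 0 R) h"
      using C(2)[of h] by simp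
  qed (use C in auto)
  moreover have "(\<integral>\<^sup>+(h::'a). ennreal (norm h powr (s + 1)) * indicator (ball 0 R) h \<partial>lborel) < \<infinity>"
    by (rule nn_integral_norm_powr_ball_finite) (use s in simp)
  ultimately show ?thesis by (auto simp: ennreal_mult_less_top intro: order.strict_trans1)
qed

text \<open>
  A normalised meromorphic function has no exceptional values: agreement near a point with a function
  continuous there extends to the point.
\<close>

lemma nicely_meromorphic_on_eqI:
  assumes "f nicely_meromorphic_on A" "z \<in> A" "isCont g z" "eventually (\<lambda>w. f w = g w) (at z)"
  shows "f z = g z"
proof -
  have lim: "(f \<longlongrightarrow> g z) (at z)"
    using assms(3,4) by (metis (mono_tags, lifting) isContD tendsto_cong)
  then have "\<not> is_pole f z"
    unfolding is_pole_def using not_tendsto_and_filterlim_at_infinity[OF at_neq_bot lim] by blast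
  then have "(f \<longlongrightarrow> f z) (at z)"
    using assms(1,2) unfolding nicely_meromorphic_on_def by blast
  then show ?thesis using lim tendsto_unique[OF at_neq_bot] by blast
qed

text \<open>
  No two points of \<open>\<Omega>\<close> have distance \<open>R\<close> or more. So the pairs in
  \<open>\<Omega> \<times> \<Omega>\<close> are all close pairs starting in \<open>\<Omega>\<close> except those
  in \<open>X\<close>, and the pairs in \<open>\<Omega> \<times> (- \<Omega>)\<close> are \<open>X\<close> together
  with all distant pairs.
\<close>

lemma riesz_integral_split:
  fixes \<Omega> :: "'a::euclidean_space set"
  assumes \<Omega>: "compact_smooth_domain \<Omega>" and R: "R > 0" "\<forall>x\<in>\<Omega>. \<forall>y\<in>\<Omega>. norm (y - x) < R"
  defines "X \<equiv> \<Omega> \<times> (- \<Omega>) \<inter> displaced \<Omega> (ball 0 R)"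
  shows "Re z > - real DIM('a) \<Longrightarrow> riesz_mass (\<Omega> \<times> \<Omega>) (Re z) < \<infinity> \<and>
     riesz_energy \<Omega> z = riesz_integral (displaced \<Omega> (ball 0 R)) z - riesz_integral X z" (is "_ \<Longrightarrow> ?E")
   and "- real DIM('a) - 1 < Re z \<Longrightarrow> Re z < - real DIM('a) \<Longrightarrow> riesz_mass (\<Omega> \<times> (- \<Omega>)) (Re z) < \<infinity> \<and>
     fractional_perimeter \<Omega> z = riesz_integral X z + riesz_integral (displaced \<Omega> (- ball 0 R)) z" (is "_ \<Longrightarrow> _ \<Longrightarrow> ?P")
proof -
  have comp: "compact \<Omega>" using \<Omega> by (simp add: compact_smooth_domain_def)
  have b: "\<Omega> \<in> sets borel" using comp by (rule borel_compact)
  have bo: "\<Omega> \<times> \<Omega> \<in> sets borel" "\<Omega> \<times> (- \<Omega>) \<in> sets borel" "X \<in> sets borel"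
    "displaced \<Omega> (ball 0 R) \<in> sets borel" "displaced \<Omega> (- ball 0 R) \<in> sets borel"
    unfolding X_def using b by (auto intro!: sets.Int borel_displaced borel_Times)
  show ?E if z: "Re z > - real DIM('a)"
  proof -
    have N: "displaced \<Omega> (ball 0 R) = \<Omega> \<times> \<Omega> \<union> X"
      using R(2) by (auto simp: X_def displaced_def)
    have fN: "riesz_mass (displaced \<Omega> (ball 0 R)) (Re z) < \<infinity>"
      by (rule riesz_mass_near_finite[OF comp z])
    have f: "riesz_mass (\<Omega> \<times> \<Omega>) (Re z) < \<infinity>" "riesz_mass X (Re z) < \<infinity>"
      using N by (auto intro: order.strict_trans1[OF riesz_mass_mono[of _ "displaced \<Omega> (ball 0 R)"] fN] simp del: infinity_ennreal_def)
    have "riesz_integral (\<Omega> \<times> \<Omega> \<union> X) z = riesz_integral (\<Omega> \<times> \<Omega>) z + riesz_integral X z"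
      by (rule riesz_integral_Un[OF _ bo(1,3) f]) (auto simp: X_def)
    then show ?thesis using f N by (simp add: riesz_energy_def)
  qed
  show ?P if z: "- real DIM('a) - 1 < Re z" "Re z < - real DIM('a)"
  proof -
    have U: "\<Omega> \<times> (- \<Omega>) = X \<union> displaced \<Omega> (- ball 0 R)"
      using R(2) by (fastforce simp: X_def displaced_def not_less)
    have f: "riesz_mass X (Re z) < \<infinity>" "riesz_mass (displaced \<Omega> (- ball 0 R)) (Re z) < \<infinity>"
      unfolding X_def using riesz_mass_exit_finite[OF \<Omega> z(1)] riesz_mass_far_finite[OF comp z(2) R(1)] by auto
    have d: "X \<inter> displaced \<Omega> (- ball 0 R) = {}"
      by (auto simp: X_def displaced_def)
    have "riesz_mass (X \<union> displaced \<Omega> (- ball 0 R)) (Re z) \<le> riesz_mass X (Re z) + riesz_mass (displaced \<Omega> (- ball 0 R)) (Re z)"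
    proof -
      have [measurable]: "(\<lambda>p::'a \<times> 'a. norm (fst p - snd p)) \<in> borel_measurable borel"
        by (intro borel_measurable_continuous_onI continuous_intros)
      show ?thesis unfolding riesz_mass_def using bo
        by (subst nn_integral_add[symmetric]) (auto intro!: nn_integral_mono simp: indicator_def)
    qed
    also have "\<dots> < \<infinity>" using f by simp
    finally show ?thesis
      using riesz_integral_Un[OF d bo(3,5) f] by (simp add: U fractional_perimeter_def)
  qed
qed

theorem riesz_energy_continues_fractional_perimeter:
  fixes \<Omega> :: "'a::euclidean_space set"
  assumes \<Omega>: "compact_smooth_domain \<Omega>" and B: "beta_function_of \<Omega> B"
  shows "(\<forall>z. - real DIM('a) - 1 < Re z \<and> Re z < - real DIM('a) \<longrightarrow>
            set_integrable lborel (\<Omega> \<times> (- \<Omega>)) (riesz_kernel z) \<and>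
            B z = - fractional_perimeter \<Omega> z) \<and>
         (\<forall>z. Re z > - real DIM('a) \<longrightarrow>
            set_integrable lborel (\<Omega> \<times> \<Omega>) (riesz_kernel z)) \<and>
         analytic_continuation_from {z. Re z > - real DIM('a)} (riesz_energy \<Omega>) B \<and>
         analytic_continuation_from {z. - real DIM('a) - 1 < Re z \<and> Re z < - real DIM('a)}
           (\<lambda>z. - fractional_perimeter \<Omega> z) B"
proof -
  define n where "n = DIM('a)"
  have comp: "compact \<Omega>" using \<Omega> by (simp add: compact_smooth_domain_def)
  have b: "\<Omega> \<in> sets borel" using comp by (rule borel_compact)
  have bo: "\<Omega> \<times> \<Omega> \<in> sets borel" "\<Omega> \<times> (- \<Omega>) \<in> sets borel"
    using b by (auto intro!: borel_Times)
  have Bn: "B nicely_meromorphic_on UNIV" and BE: "\<And>z. Re z > - real n \<Longrightarrow> B z = riesz_energy \<Omega> z"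
    using B by (auto simp: beta_function_of_def n_def)
  obtain r where r: "r > 0" "\<And>x. x \<in> \<Omega> \<Longrightarrow> norm x \<le> r"
    using compact_imp_bounded[OF comp] by (auto simp: bounded_pos)
  define R where "R = 2 * r + 1"
  have R: "R > 0" "\<forall>x\<in>\<Omega>. \<forall>y\<in>\<Omega>. norm (y - x) < R"
  proof -
    show "R > 0" using r(1) by (simp add: R_def)
    show "\<forall>x\<in>\<Omega>. \<forall>y\<in>\<Omega>. norm (y - x) < R"
    proof (intro ballI)
      fix x y assume "x \<in> \<Omega>" "y \<in> \<Omega>"
      then show "norm (y - x) < R"
        using norm_triangle_ineq4[of y x] r(2)[of x] r(2)[of y] by (simp add: R_def)
    qed
  qed
  define X where "X = \<Omega> \<times> (- \<Omega>) \<inter> displaced \<Omega> (ball 0 R)"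
  define A where "A = displaced \<Omega> (ball 0 (2 * R) - ball 0 R)"
  define q where "q z = (2::complex) powr (z + of_nat n) - 1" for z
  note split = riesz_integral_split[OF \<Omega> R, folded X_def n_def]
  have near: "riesz_integral A z = q z * riesz_integral (displaced \<Omega> (ball 0 R)) z" if "Re z > - real n" for z
    using riesz_integral_annulus_near[OF comp R(1), of z] that by (simp add: A_def q_def n_def)
  have far: "riesz_integral A z = - q z * riesz_integral (displaced \<Omega> (- ball 0 R)) z" if "Re z < - real n" for z
    using riesz_integral_annulus_far[OF comp R(1), of z] that by (simp add: A_def q_def n_def)
  have XA: "X \<in> sets borel" "A \<in> sets borel"
    unfolding X_def A_def using b by (auto intro!: sets.Int borel_displaced borel_Times)
  have hX: "riesz_integral X holomorphic_on {z. Re z \<in> {- real n - 1<..}}"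
    using riesz_mass_exit_finite[OF \<Omega>, of _ R]
    by (intro holomorphic_on_riesz_integral XA) (auto simp: X_def n_def)
  have hA: "riesz_integral A holomorphic_on {z. Re z \<in> UNIV}"
    using riesz_mass_annulus_finite[OF comp R(1)]
    by (intro holomorphic_on_riesz_integral XA) (auto simp: A_def)
  have hE: "riesz_energy \<Omega> holomorphic_on {z. Re z \<in> {- real n<..}}"
  proof -
    have "riesz_mass (\<Omega> \<times> \<Omega>) s < \<infinity>" if "s \<in> {- real n<..}" for s
      using split(1)[of "of_real s"] that by simp
    from holomorphic_on_riesz_integral[OF bo(1) open_greaterThan this] show ?thesis
      by (simp add: riesz_energy_def[abs_def])
  qed
  have hP: "fractional_perimeter \<Omega> holomorphic_on {z. Re z \<in> {- real n - 1<..<- real n}}"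
  proof -
    have "riesz_mass (\<Omega> \<times> (- \<Omega>)) s < \<infinity>" if "s \<in> {- real n - 1<..<- real n}" for s
      using split(2)[of "of_real s"] that by simp
    from holomorphic_on_riesz_integral[OF bo(2) open_greaterThanLessThan this] show ?thesis
      by (simp add: fractional_perimeter_def[abs_def])
  qed
  define H where "H = {z. - real n - 1 < Re z}"
  \<comment> \<open>Multiplying by \<open>q\<close> clears the denominator in the continuation of the ball integral: \<open>f\<close>
      vanishes on the right half plane, hence up to isolated points on the connected set \<open>H\<close>.\<close>
  define f where "f z = (B z + riesz_integral X z) * q z - riesz_integral A z" for z
  have H: "open H" "connected H"
    unfolding H_def by (auto intro: open_halfspace_Re_gt convex_connected convex_halfspace_Re_gt)
  have "f meromorphic_on H"
  proof -
    have "B meromorphic_on H"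
      using Bn meromorphic_on_subset unfolding nicely_meromorphic_on_def by blast
    moreover have "riesz_integral X meromorphic_on H"
      using hX H by (intro analytic_on_imp_meromorphic_on) (simp add: analytic_on_open H_def)
    moreover have "riesz_integral A meromorphic_on H"
      using hA H holomorphic_on_subset[of _ UNIV H]
      by (intro analytic_on_imp_meromorphic_on) (simp add: analytic_on_open)
    moreover have "q holomorphic_on H" unfolding q_def by (intro holomorphic_intros) auto
    then have "q meromorphic_on H"
      using H by (intro analytic_on_imp_meromorphic_on) (simp add: analytic_on_open)
    ultimately show ?thesis unfolding f_def by (intro meromorphic_on_diff meromorphic_on_mult meromorphic_on_add)
  qed
  then have "eventually (\<lambda>z. f z = 0) (cosparse H) \<or> eventually (\<lambda>z. f z \<noteq> 0) (cosparse H)"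
    using H by (rule meromorphic_imp_constant_or_avoid)
  then have f0: "eventually (\<lambda>w. f w = 0) (at z)" if "z \<in> H" for z
  proof
    assume "eventually (\<lambda>z. f z \<noteq> 0) (cosparse H)"
    moreover have "1 \<in> H" by (simp add: H_def)
    ultimately have "eventually (\<lambda>w. f w \<noteq> 0) (at 1)"
      using H(1) by (simp add: eventually_cosparse_open_eq)
    moreover have "eventually (\<lambda>w. w \<in> {z. Re z > - real n}) (at 1)"
      by (intro eventually_at_in_open') (auto intro: open_halfspace_Re_gt)
    ultimately have "eventually (\<lambda>w::complex. False) (at 1)"
    proof eventually_elim
      case (elim w)
      then have w: "Re w > - real n" by simp
      have "f w = 0" using near[OF w] split(1)[OF w] BE[OF w] by (simp add: f_def)
      then show ?case using elim by simp
    qed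
    then show ?thesis by simp
  qed (use that H(1) in \<open>simp add: eventually_cosparse_open_eq\<close>)
  have BP: "B z = - fractional_perimeter \<Omega> z" if z: "- real n - 1 < Re z" "Re z < - real n" for z
  proof -
    let ?S = "{z. Re z \<in> {- real n - 1<..<- real n}}"
    have S: "open ?S" "z \<in> ?S"
      using z by (auto intro!: open_Collect_conj open_halfspace_Re_gt open_halfspace_Re_lt)
    have "eventually (\<lambda>w. f w = 0) (at z)" using f0 z by (simp add: H_def)
    moreover have "eventually (\<lambda>w. w \<in> ?S) (at z)" by (rule eventually_at_in_open'[OF S])
    ultimately have "eventually (\<lambda>w. B w = - fractional_perimeter \<Omega> w) (at z)"
    proof eventually_elim
      case (elim w)
      then have w: "- real n - 1 < Re w" "Re w < - real n" by auto
      have "q w * (B w + riesz_integral X w + riesz_integral (displaced \<Omega> (- ball 0 R)) w) = 0"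
        using elim(1) far[OF w(2)] by (simp add: f_def algebra_simps)
      moreover have "q w \<noteq> 0" using two_powr_neq_1[of w n] w by (simp add: q_def)
      ultimately have "B w + (riesz_integral X w + riesz_integral (displaced \<Omega> (- ball 0 R)) w) = 0"
        by (simp add: add.assoc)
      then show ?case using split(2)[OF w] by (metis eq_neg_iff_add_eq_0)
    qed
    moreover have "isCont (\<lambda>z. - fractional_perimeter \<Omega> z) z"
      using holomorphic_on_imp_continuous_on[OF hP] S
      by (intro continuous_intros) (simp add: continuous_on_eq_continuous_at)
    ultimately show ?thesis using nicely_meromorphic_on_eqI[OF Bn] by blast
  qed
  have "set_integrable lborel (\<Omega> \<times> (- \<Omega>)) (riesz_kernel z)" if "- real n - 1 < Re z" "Re z < - real n" for z
    using split(2)[OF that] by (intro set_integrable_riesz_kernel bo) auto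
  moreover have "set_integrable lborel (\<Omega> \<times> \<Omega>) (riesz_kernel z)" if "Re z > - real n" for z
    using split(1)[OF that] by (intro set_integrable_riesz_kernel bo) auto
  moreover have "analytic_continuation_from {z. Re z > - real n} (riesz_energy \<Omega>) B"
  proof -
    have "1 \<in> {z. Re z > - real n}" by simp
    then have "{z. Re z > - real n} \<noteq> {}" by blast
    then show ?thesis unfolding analytic_continuation_from_def
      using hE Bn BE open_halfspace_Re_gt[of "- real n"] by auto
  qed
  moreover have "analytic_continuation_from {z. - real n - 1 < Re z \<and> Re z < - real n}
      (\<lambda>z. - fractional_perimeter \<Omega> z) B"
  proof -
    have "of_real (- real n - 1 / 2) \<in> {z. - real n - 1 < Re z \<and> Re z < - real n}" by simp
    then have "{z. - real n - 1 < Re z \<and> Re z < - real n} \<noteq> {}" by blast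
    moreover have "open {z. - real n - 1 < Re z \<and> Re z < - real n}"
      by (intro open_Collect_conj open_halfspace_Re_gt open_halfspace_Re_lt)
    ultimately show ?thesis unfolding analytic_continuation_from_def
      using holomorphic_on_minus[OF hP] Bn BP by auto
  qed
  ultimately show ?thesis using BP unfolding n_def by blast
qed

theorem mainTheorem6:
  fixes \<Omega> :: "(real ^ 'n) set" and B :: "complex \<Rightarrow> complex"
  assumes "compact_smooth_domain \<Omega>"
    and "beta_function_of \<Omega> B"
  shows "(\<forall>z. - real CARD('n) - 1 < Re z \<and> Re z < - real CARD('n) \<longrightarrow>
            set_integrable lborel (\<Omega> \<times> (- \<Omega>)) (riesz_kernel z) \<and>
            B z = - fractional_perimeter \<Omega> z) \<and>
         (\<forall>z. Re z > - real CARD('n) \<longrightarrow>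
            set_integrable lborel (\<Omega> \<times> \<Omega>) (riesz_kernel z)) \<and>
         analytic_continuation_from {z. Re z > - real CARD('n)} (riesz_energy \<Omega>) B \<and>
         analytic_continuation_from {z. - real CARD('n) - 1 < Re z \<and> Re z < - real CARD('n)}
           (\<lambda>z. - fractional_perimeter \<Omega> z) B"
  using riesz_energy_continues_fractional_perimeter[OF assms] by simp

end
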